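(* Let $n\ge 1$ and $A\in\mathbb{R}^{n\times n}$. Then $\mathrm{Gdet}(A)=\det(A)$.
   Context: All matrices are real. Let $m\ge n\ge 1$. $S_m$ is the symmetric group on $\{1,\dots,m\}$ with identity element $(1)$. For $\sigma\in S_m$ let $\Phi(\sigma)$ be the $m\times m$ permutation matrix whose $i$-th row is $e_{\sigma(i)}^T$ ($e_j$ = $j$-th column of $I_m$), let $I_{m\times n}=(e_1,\dots,e_n)$, and $P_\sigma=\Phi(\sigma)I_{m\times n}\in\mathbb{R}^{m\times n}$. For $A\in\mathbb{R}^{m\times n}$ put $A^\sigma=P_\sigma^TA\in\mathbb{R}^{n\times n}$ (so the $j$-th row of $A^\sigma$ is the $\sigma^{-1}(j)$-th row of $A$). Totally order $S_m$ by: $\sigma>\tau$ iff there is $t$ with $\sigma(t)>\tau(t)$ and $\sigma(j)=\tau(j)$ for all $j>t$. Let $\sigma_A=(1)$ if $A$ is not of full column rank, and otherwise $\sigma_A=\max\{\sigma\in S_m:\det(A^\sigma)\neq 0\}$. The principal submatrix of $A$ is $A_P=A^{\sigma_A}$, and $\mathrm{sign}(A)\in\{1,0,-1\}$ is the sign of the real number $\det(A_P)$. If $m<n$, $\mathrm{sign}(A)=0$. The generalized determinant of $A\in\mathbb{R}^{m\times n}$ is $$\mathrm{Gdet}(A)=\mathrm{sign}(A)\Big(\sum_{1\le i_1<\dots<i_n\le m}\det(A_{i_1,\dots,i_n})^2\Big)^{1/2}\ \text{ if } m\ge n,\qquad \mathrm{Gdet}(A)=0\ \text{ if } m<n,$$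 where $A_{i_1,\dots,i_n}$ is the $n\times n$ submatrix formed by rows $i_1,\dots,i_n$ of $A$. *)

theory Defs
  imports
    Complex_Main
    "HOL-Combinatorics.Permutations"
    "Jordan_Normal_Form.DL_Rank"
    "Jordan_Normal_Form.DL_Submatrix"
begin

text \<open>
  Matrices are those of Jordan-Normal-Form, whose indices start at 0. The index set
  \<open>{1,\<dots>,m}\<close> of the mathematics is therefore shifted to \<open>{..<m}\<close>, and \<open>S\<^sub>m\<close> is the set of
  all \<open>\<sigma>\<close> with \<open>\<sigma> permutes {..<m}\<close>. The order on permutations, the row order in minors and
  the order of the columns of the identity matrix are unaffected by the shift.
\<close>

definition Sym :: "nat \<Rightarrow> (nat \<Rightarrow> nat) set" where
  "Sym m = {\<sigma>. \<sigma> permutes {..<m}}"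

definition perm_less :: "nat \<Rightarrow> (nat \<Rightarrow> nat) \<Rightarrow> (nat \<Rightarrow> nat) \<Rightarrow> bool" where
  "perm_less m \<tau> \<sigma> \<longleftrightarrow>
     (\<exists>t<m. \<sigma> t > \<tau> t \<and> (\<forall>j. t < j \<and> j < m \<longrightarrow> \<sigma> j = \<tau> j))"

definition perm_mat :: "nat \<Rightarrow> (nat \<Rightarrow> nat) \<Rightarrow> real mat" where
  "perm_mat m \<sigma> = mat_of_rows m (map (\<lambda>i. unit_vec m (\<sigma> i)) [0..<m])"

definition id_rect :: "nat \<Rightarrow> nat \<Rightarrow> real mat" where
  "id_rect m n = mat_of_cols m (map (unit_vec m) [0..<n])"

definition P_mat :: "nat \<Rightarrow> nat \<Rightarrow> (nat \<Rightarrow> nat) \<Rightarrow> real mat" where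
  "P_mat m n \<sigma> = perm_mat m \<sigma> * id_rect m n"

definition row_select :: "real mat \<Rightarrow> (nat \<Rightarrow> nat) \<Rightarrow> real mat" where
  "row_select A \<sigma> = transpose_mat (P_mat (dim_row A) (dim_col A) \<sigma>) * A"

definition full_column_rank :: "real mat \<Rightarrow> bool" where
  "full_column_rank A \<longleftrightarrow> vec_space.rank (dim_row A) A = dim_col A"

definition nonsing_perms :: "real mat \<Rightarrow> (nat \<Rightarrow> nat) set" where
  "nonsing_perms A = {\<sigma> \<in> Sym (dim_row A). det (row_select A \<sigma>) \<noteq> 0}"

text \<open>
  The maximum is taken with respect to \<^const>\<open>perm_less\<close>, not with respect to the pointwise
  order that functions carry by default. The set is nonempty if \<open>A\<close> has full column rank,
  and by \<open>ex1_perm_max\<close> below the description is then well defined.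
\<close>

definition sigma_max :: "real mat \<Rightarrow> (nat \<Rightarrow> nat)" where
  "sigma_max A =
     (if full_column_rank A
      then (THE \<sigma>. \<sigma> \<in> nonsing_perms A \<and>
              (\<forall>\<tau>\<in>nonsing_perms A. \<tau> \<noteq> \<sigma> \<longrightarrow> perm_less (dim_row A) \<tau> \<sigma>))
      else id)"

definition principal_submatrix :: "real mat \<Rightarrow> real mat" where
  "principal_submatrix A = row_select A (sigma_max A)"

definition mat_sign :: "real mat \<Rightarrow> real" where
  "mat_sign A = (if dim_row A < dim_col A then 0 else sgn (det (principal_submatrix A)))"

text \<open>
  A choice of rows \<open>i\<^sub>1 < \<dots> < i\<^sub>n\<close> is encoded by the set of these rows; \<^const>\<open>submatrix\<close>
  lists the selected rows in increasing order.
\<close>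

definition Gdet :: "real mat \<Rightarrow> real" where
  "Gdet A =
     (if dim_col A \<le> dim_row A
      then mat_sign A *
        sqrt (\<Sum>I | I \<subseteq> {..<dim_row A} \<and> card I = dim_col A. (det (submatrix A I UNIV))\<^sup>2)
      else 0)"

lemma perm_less_asym: "perm_less m \<sigma> \<tau> \<Longrightarrow> \<not> perm_less m \<tau> \<sigma>"
  unfolding perm_less_def by (metis less_asym linorder_neqE_nat)

lemma perm_less_trans:
  assumes "perm_less m \<rho> \<tau>" "perm_less m \<tau> \<sigma>"
  shows "perm_less m \<rho> \<sigma>"
proof -
  obtain s where s: "s < m" "\<rho> s < \<tau> s" "\<And>j. s < j \<Longrightarrow> j < m \<Longrightarrow> \<tau> j = \<rho> j"
    using assms(1) unfolding perm_less_def by blast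
  obtain t where t: "t < m" "\<tau> t < \<sigma> t" "\<And>j. t < j \<Longrightarrow> j < m \<Longrightarrow> \<sigma> j = \<tau> j"
    using assms(2) unfolding perm_less_def by blast
  have "\<rho> (max s t) < \<sigma> (max s t)"
    using s t by (cases s t rule: linorder_cases) (auto simp: max_def)
  moreover have "\<forall>j. max s t < j \<and> j < m \<longrightarrow> \<sigma> j = \<rho> j"
    using s(3) t(3) by auto
  ultimately show ?thesis
    unfolding perm_less_def using s(1) t(1) by (intro exI[of _ "max s t"]) auto
qed

lemma perm_less_total:
  assumes "\<sigma> \<in> Sym m" "\<tau> \<in> Sym m" "\<sigma> \<noteq> \<tau>"
  shows "perm_less m \<sigma> \<tau> \<or> perm_less m \<tau> \<sigma>"
proof -
  define D where "D = {j. j < m \<and> \<sigma> j \<noteq> \<tau> j}"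
  have fin: "finite D" unfolding D_def by auto
  have ne: "D \<noteq> {}"
  proof
    assume "D = {}"
    then have "\<sigma> j = \<tau> j" for j
      using assms(1,2) unfolding D_def Sym_def
      by (cases "j < m") (auto simp: permutes_def)
    then show False using assms(3) by blast
  qed
  have "Max D \<in> D" using Max_in[OF fin ne] .
  moreover have "\<sigma> j = \<tau> j" if "Max D < j" "j < m" for j
    using Max_ge[OF fin, of j] that unfolding D_def by fastforce
  ultimately show ?thesis
    unfolding perm_less_def D_def[symmetric]
    by (metis (mono_tags, lifting) D_def linorder_neqE_nat mem_Collect_eq)
qed

lemma ex1_perm_max:
  assumes "S \<subseteq> Sym m" "S \<noteq> {}"
  shows "\<exists>!\<sigma>. \<sigma> \<in> S \<and> (\<forall>\<tau>\<in>S. \<tau> \<noteq> \<sigma> \<longrightarrow> perm_less m \<tau> \<sigma>)"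
proof -
  have "finite S"
    using assms(1) finite_subset finite_permutations[of "{..<m}"] unfolding Sym_def by blast
  then have "\<exists>\<sigma>. \<sigma> \<in> S \<and> (\<forall>\<tau>\<in>S. \<tau> \<noteq> \<sigma> \<longrightarrow> perm_less m \<tau> \<sigma>)"
    using assms(2,1)
  proof (induction S rule: finite_ne_induct)
    case (singleton x)
    then show ?case by auto
  next
    case (insert x F)
    then obtain \<sigma> where \<sigma>: "\<sigma> \<in> F" "\<forall>\<tau>\<in>F. \<tau> \<noteq> \<sigma> \<longrightarrow> perm_less m \<tau> \<sigma>"
      by auto
    have "perm_less m x \<sigma> \<or> perm_less m \<sigma> x"
      using perm_less_total[of x m \<sigma>] insert \<sigma>(1) by blast
    then show ?case
    proof
      assume "perm_less m x \<sigma>"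
      then show ?thesis using \<sigma> by (intro exI[of _ \<sigma>]) auto
    next
      assume *: "perm_less m \<sigma> x"
      then have "perm_less m \<tau> x" if "\<tau> \<in> F" for \<tau>
        using \<sigma>(2) perm_less_trans[OF _ *] that by (cases "\<tau> = \<sigma>") auto
      then show ?thesis by (intro exI[of _ x]) auto
    qed
  qed
  then obtain \<sigma> where \<sigma>: "\<sigma> \<in> S" "\<forall>\<tau>\<in>S. \<tau> \<noteq> \<sigma> \<longrightarrow> perm_less m \<tau> \<sigma>"
    by auto
  show ?thesis
  proof (rule ex1I[of _ \<sigma>])
    fix \<rho>
    assume \<rho>: "\<rho> \<in> S \<and> (\<forall>\<tau>\<in>S. \<tau> \<noteq> \<rho> \<longrightarrow> perm_less m \<tau> \<rho>)"
    show "\<rho> = \<sigma>"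
    proof (rule ccontr)
      assume "\<rho> \<noteq> \<sigma>"
      then show False using \<sigma> \<rho> perm_less_asym[of m \<rho> \<sigma>] by simp
    qed
  qed (use \<sigma> in blast)
qed

lemma row_select_index:
  assumes "\<sigma> \<in> Sym (dim_row A)" "dim_col A \<le> dim_row A" "j < dim_col A" "k < dim_col A"
  shows "row_select A \<sigma> $$ (j, k) = A $$ (inv_into UNIV \<sigma> j, k)"
proof -
  let ?m = "dim_row A" and ?n = "dim_col A"
  have p: "\<sigma> permutes {..<?m}" using assms(1) by (simp add: Sym_def)
  have lt: "\<sigma> i < ?m \<longleftrightarrow> i < ?m" for i using permutes_in_image[OF p, of i] by simp
  have P: "P_mat ?m ?n \<sigma> $$ (i, j) = (if \<sigma> i = j then 1 else 0)" if "i < ?m" for i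
    using that assms(2,3) lt[of i]
    by (simp add: P_mat_def perm_mat_def id_rect_def mat_of_rows_def mat_of_cols_def
        scalar_prod_def unit_vec_def row_def col_def if_distrib sum.If_cases cong: if_cong)
  have dims: "dim_row (P_mat ?m ?n \<sigma>) = ?m" "dim_col (P_mat ?m ?n \<sigma>) = ?n"
    by (simp_all add: P_mat_def perm_mat_def id_rect_def)
  have "row_select A \<sigma> $$ (j, k) = (\<Sum>i<?m. P_mat ?m ?n \<sigma> $$ (i, j) * A $$ (i, k))"
    using assms(3,4) dims
    by (simp add: row_select_def scalar_prod_def lessThan_atLeast0)
  also have "\<dots> = (\<Sum>i<?m. if i = inv_into UNIV \<sigma> j then A $$ (i, k) else 0)"
  proof (rule sum.cong[OF refl])
    fix i
    assume "i \<in> {..<?m}"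
    moreover have "i = inv_into UNIV \<sigma> j \<longleftrightarrow> \<sigma> i = j"
      using permutes_inv_eq[OF p, of j i] by metis
    ultimately show "P_mat ?m ?n \<sigma> $$ (i, j) * A $$ (i, k) =
        (if i = inv_into UNIV \<sigma> j then A $$ (i, k) else 0)"
      by (simp add: P)
  qed
  also have "\<dots> = A $$ (inv_into UNIV \<sigma> j, k)"
    using assms(2,3) permutes_in_image[OF permutes_inv[OF p], of j] by simp
  finally show ?thesis .
qed

end

theory Submission
  imports Defs
begin

text \<open>A square matrix has a single maximal minor, so the root in \<open>Gdet A\<close> is the
  absolute value of \<open>det A\<close> and only the sign is in question. If \<open>det A\<close>
  is 0, both sides vanish. Otherwise \<open>id\<close> is an admissible permutation, and it is the
  greatest of all (\<open>perm_less_id\<close>); hence the principal submatrix is \<open>A\<close>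
  itself and its sign restores \<open>det A\<close>.\<close>

lemma id_in_Sym: "id \<in> Sym m"
  by (simp add: Sym_def permutes_id)

lemma perm_less_id:
  assumes "\<sigma> \<in> Sym m" "\<sigma> \<noteq> id"
  shows "perm_less m \<sigma> id"
proof -
  have p: "\<sigma> permutes {..<m}" using assms(1) by (simp add: Sym_def)
  have "\<not> perm_less m id \<sigma>"
  proof
    assume "perm_less m id \<sigma>"
    then obtain t where t: "t < m" "t < \<sigma> t" "\<And>j. t < j \<Longrightarrow> j < m \<Longrightarrow> \<sigma> j = j"
      unfolding perm_less_def by auto
    have "\<sigma> t < m" using permutes_in_image[OF p, of t] t(1) by simp
    \<comment> \<open>Every index above \<open>t\<close> is fixed by \<open>\<sigma>\<close>, and
      \<open>\<sigma> t\<close> is such an index; injectivity then forces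
      \<open>\<sigma> t = t\<close>.\<close>
    then have "\<sigma> (\<sigma> t) = \<sigma> t" using t by blast
    then have "\<sigma> t = t" using permutes_inj[OF p] by (simp add: inj_eq)
    then show False using t(2) by simp
  qed
  then show ?thesis using perm_less_total[OF assms(1) id_in_Sym assms(2)] by blast
qed

text \<open>Both branches of \<open>sigma_max\<close> give \<open>id\<close>: the maximum because
  \<open>id\<close> tops the order, the rank-deficient case by convention.\<close>

lemma sigma_max_eq_id:
  assumes "id \<in> nonsing_perms A"
  shows "sigma_max A = id"
proof -
  have "(THE \<sigma>. \<sigma> \<in> nonsing_perms A \<and>
      (\<forall>\<tau>\<in>nonsing_perms A. \<tau> \<noteq> \<sigma> \<longrightarrow> perm_less (dim_row A) \<tau> \<sigma>)) = id"
  proof (rule the1_equality[OF ex1_perm_max])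
    show "nonsing_perms A \<subseteq> Sym (dim_row A)" by (auto simp: nonsing_perms_def)
    then show "id \<in> nonsing_perms A \<and>
        (\<forall>\<tau>\<in>nonsing_perms A. \<tau> \<noteq> id \<longrightarrow> perm_less (dim_row A) \<tau> id)"
      using assms perm_less_id by blast
  qed (use assms in blast)
  then show ?thesis by (simp add: sigma_max_def)
qed

lemma row_select_id:
  assumes "A \<in> carrier_mat n n"
  shows "row_select A id = A"
proof (rule eq_matI)
  show "row_select A id $$ (i, j) = A $$ (i, j)" if "i < dim_row A" "j < dim_col A" for i j
    using row_select_index[OF id_in_Sym, of A i j] that assms by simp
qed (use assms in \<open>simp_all add: row_select_def P_mat_def id_rect_def\<close>)

lemma submatrix_all_rows:
  assumes "A \<in> carrier_mat m n"
  shows "submatrix A {..<m} UNIV = A"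
proof -
  \<comment> \<open>An initial segment and \<open>UNIV\<close> have the same \<open>i\<close>-th
    element for \<open>i < m\<close>.\<close>
  have pick: "pick {..<m} i = i" if "i < m" for i
    using pick_reduce_set[of i m UNIV] that by (simp add: pick_UNIV lessThan_def)
  show ?thesis
  proof (rule eq_matI)
    show "submatrix A {..<m} UNIV $$ (i, j) = A $$ (i, j)"
      if "i < dim_row A" "j < dim_col A" for i j
      using that assms submatrix_index[of i A "{..<m}" j UNIV] by (simp add: pick pick_UNIV)
  qed (use assms in \<open>simp_all add: dim_submatrix\<close>)
qed

theorem theorem3p2:
  fixes A :: "real mat" and n :: nat
  assumes "n \<ge> 1" and "A \<in> carrier_mat n n"
  shows "Gdet A = det A"
proof -
  have dims: "dim_row A = n" "dim_col A = n" using assms(2) by auto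
  \<comment> \<open>The sum of squared minors thus collapses to the square of
    \<open>det A\<close>.\<close>
  have "{I. I \<subseteq> {..<n} \<and> card I = n} = {{..<n}}"
    using card_subset_eq[of "{..<n}"] by auto
  then have Gdet: "Gdet A = sgn (det (principal_submatrix A)) * \<bar>det A\<bar>"
    using submatrix_all_rows[OF assms(2)] by (simp add: Gdet_def mat_sign_def dims)
  show ?thesis
  proof (cases "det A = 0")
    case True
    then show ?thesis using Gdet by simp
  next
    case False
    then have "id \<in> nonsing_perms A"
      by (simp add: nonsing_perms_def id_in_Sym row_select_id[OF assms(2)])
    then have "principal_submatrix A = A"
      by (simp add: principal_submatrix_def sigma_max_eq_id row_select_id[OF assms(2)])
    then show ?thesis using Gdet by (simp add: sgn_mult_abs)
  qed
qed

end
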